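(* Consider the two-player non-cooperative bus game on the circuit of length $D$ with starting positions $x_0,y_0\in[0,D)$, time $T>0$ and speed set $\Gamma=[v_{min},v_{max}]$, where $Tv_{max}<D/2$ (payoffs $u_{\mathbf x},u_{\mathbf y}$ as in the context). Let $d_0=\min\{d_{\mathbf x}(x_0,y_0),d_{\mathbf y}(x_0,y_0)\}$ and $d=T(v_{max}-v_{min})$, and assume (without loss of generality) that $d_0=d_{\mathbf x}(x_0,y_0)$. In each pair below the first entry is the strategy of $\mathbf x$ and the second that of $\mathbf y$. a) If $d_0=0$, then the pair of strategies $(v_{max},v_{max})$ is the only Nash equilibrium. b) If $0<d_0<d<d_{\mathbf y}(x_0,y_0)$, then for all sufficiently small $\varepsilon>0$ the following pair $(X,Y)$ is a mixed strategy $\varepsilon$-equilibrium: $$X=\begin{cases} v_{min} & \text{with probability } 1-\frac{d-d_0}{D},\\ U & \text{with probability } \frac{d-d_0}{D},\end{cases}\qquad Y=\begin{cases} v_{min} & \text{with probability } q_1,\\ V & \text{with probability } q_2,\\ v_{max}-\frac{d_0}{T}+\frac{\varepsilon}{T} & \text{with probability } 1-\frac{d}{D},\end{cases}$$ where $U$ is a uniform random variable on $\left(v_{min}+\frac{d_0}{T},v_{max}\right)$, $q_1$ and $q_2$ are non-negative numbers such that $q_1+q_2=\frac{d}{D}$ and $q_2\le\frac{d-d_0}{D}$, and $V$ is a uniform random variable on $\left(v_{max}-\frac{d_0}{T}-q_2\frac{D}{T},\,v_{max}-\frac{d_0}{T}\right)$. c) If $0<d=d_0<d_{\mathbf y}(x_0,y_0)$,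 then for all sufficiently small $\varepsilon>0$ the following pair $(X,Y)$ is a mixed strategy $\varepsilon$-equilibrium: $$X=\begin{cases} v_{min} & \text{with probability } 1-\frac{2\varepsilon}{D},\\ v_{max} & \text{with probability } \frac{2\varepsilon}{D},\end{cases}\qquad Y=\begin{cases} v_{min} & \text{with probability } \frac{2d}{D},\\ v_{min}+\frac{\varepsilon}{T} & \text{with probability } 1-\frac{2d}{D}.\end{cases}$$ d) If $d<d_0$, then the pair of strategies $(v_{min},v_{min})$ is the unique Nash equilibrium.
   Context: Fix real constants $D>0$, $T>0$, $0<v_{min}\le v_{max}$, $\lambda>0$, $p\ge 0$, $c\ge 0$, with $Tv_{max}<D/2$. The set of pure strategies (speeds) of each of the two players $\mathbf x,\mathbf y$ is $\Gamma=\{v: v_{min}\le v\le v_{max}\}$. For real $r$ let $(r)_{mod\,D}=D\left(\frac rD-\lfloor \frac rD\rfloor\right)\in[0,D)$. For positions $x,y\in[0,D)$ the directed distances are $$d_{\mathbf x}(x,y)=\begin{cases} y-x & x\le y\\ D+y-x & x>y\end{cases},\qquad d_{\mathbf y}(x,y)=\begin{cases} x-y & y\le x\\ D+x-y & y>x.\end{cases}$$ Given starting positions $x_0,y_0\in[0,D)$ and speeds $v_{\mathbf x},v_{\mathbf y}\in\Gamma$, the final positions are $x_T=(x_0+Tv_{\mathbf x})_{mod\,D}$ and $y_T=(y_0+Tv_{\mathbf y})_{mod\,D}$. Non-cooperative payoffs: $$u_{\mathbf x}(x_0,v_{\mathbf x},y_0,v_{\mathbf y})=\begin{cases} p\lambda\,d_{\mathbf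 x}(x_T,y_T)-cT & x_T\ne y_T\\ p\lambda\frac D2-cT & x_T=y_T\end{cases},\qquad u_{\mathbf y}(x_0,v_{\mathbf x},y_0,v_{\mathbf y})=\begin{cases} p\lambda\,d_{\mathbf y}(x_T,y_T)-cT & x_T\ne y_T\\ p\lambda\frac D2-cT & x_T=y_T.\end{cases}$$ A mixed strategy is a random variable with values in $\Gamma$; the two players' mixed strategies $X$ (of $\mathbf x$) and $Y$ (of $\mathbf y$) are independent, and the expected payoffs are $U_{\mathbf x}(x_0,X,y_0,Y)=\mathbb E[u_{\mathbf x}(x_0,X,y_0,Y)]$ and $U_{\mathbf y}(x_0,X,y_0,Y)=\mathbb E[u_{\mathbf y}(x_0,X,y_0,Y)]$. For $\varepsilon\geq 0$, a pair of strategies is an $\varepsilon$-equilibrium if no player can increase her (expected) payoff by more than $\varepsilon$ by unilaterally changing her strategy; a Nash equilibrium is the case $\varepsilon=0$. A description such as "$X=a$ with probability $\pi$, $X=U$ with probability $1-\pi$" means that the law of $X$ is the corresponding mixture of the point mass at $a$ and the law of $U$ (components of probability $0$ are ignored).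
   Formalization: Uniqueness in a), d) is claimed only if p>0 or v_min=v_max; in b), c) the pair is a pλε-equilibrium instead of an ε-equilibrium; in b), if p>0, q2 must equal (d−d0)/D (so q1=d0/D). As printed, these claims fail for some parameters. *)

theory Defs
  imports "HOL-Probability.Probability"
begin

section \<open>The circuit and the pure payoffs\<close>

definition mod_circ :: "real \<Rightarrow> real \<Rightarrow> real" where
  "mod_circ D r = D * (r / D - of_int \<lfloor>r / D\<rfloor>)"

definition dist_x :: "real \<Rightarrow> real \<Rightarrow> real \<Rightarrow> real" where
  "dist_x D x y = (if x \<le> y then y - x else D + y - x)"

definition dist_y :: "real \<Rightarrow> real \<Rightarrow> real \<Rightarrow> real" where
  "dist_y D x y = (if y \<le> x then x - y else D + x - y)"

definition final_pos :: "real \<Rightarrow> real \<Rightarrow> real \<Rightarrow> real \<Rightarrow> real" where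
  "final_pos D T z v = mod_circ D (z + T * v)"

definition payoff_x ::
  "real \<Rightarrow> real \<Rightarrow> real \<Rightarrow> real \<Rightarrow> real \<Rightarrow> real \<Rightarrow> real \<Rightarrow> real \<Rightarrow> real \<Rightarrow> real" where
  "payoff_x D T lam p c x0 vx y0 vy =
     (let xT = final_pos D T x0 vx; yT = final_pos D T y0 vy in
      if xT \<noteq> yT then p * lam * dist_x D xT yT - c * T
      else p * lam * (D / 2) - c * T)"

definition payoff_y ::
  "real \<Rightarrow> real \<Rightarrow> real \<Rightarrow> real \<Rightarrow> real \<Rightarrow> real \<Rightarrow> real \<Rightarrow> real \<Rightarrow> real \<Rightarrow> real" where
  "payoff_y D T lam p c x0 vx y0 vy =
     (let xT = final_pos D T x0 vx; yT = final_pos D T y0 vy in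
      if xT \<noteq> yT then p * lam * dist_y D xT yT - c * T
      else p * lam * (D / 2) - c * T)"


section \<open>Mixed strategies and equilibria\<close>

text \<open>A mixed strategy is represented by its law, a Borel probability measure concentrated
  on the set of pure strategies; a pure strategy is a point mass.  Independence of the two
  players' choices makes the joint law the product measure.\<close>

definition mixed_strategies :: "real set \<Rightarrow> real measure set" where
  "mixed_strategies S = {M. prob_space M \<and> sets M = sets borel \<and> emeasure M S = 1}"

definition expected_payoff ::
  "(real \<Rightarrow> real \<Rightarrow> real) \<Rightarrow> real measure \<Rightarrow> real measure \<Rightarrow> real" where
  "expected_payoff u X Y = (\<integral>(v, w). u v w \<partial>(X \<Otimes>\<^sub>M Y))"

definition eps_equilibrium ::
  "real set \<Rightarrow> (real \<Rightarrow> real \<Rightarrow> real) \<Rightarrow> (real \<Rightarrow> real \<Rightarrow> real) \<Rightarrow> real \<Rightarrow>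
   real measure \<Rightarrow> real measure \<Rightarrow> bool" where
  "eps_equilibrium S ux uy eps X Y \<longleftrightarrow>
     X \<in> mixed_strategies S \<and> Y \<in> mixed_strategies S \<and>
     (\<forall>X' \<in> mixed_strategies S. expected_payoff ux X' Y \<le> expected_payoff ux X Y + eps) \<and>
     (\<forall>Y' \<in> mixed_strategies S. expected_payoff uy X Y' \<le> expected_payoff uy X Y + eps)"

definition bus_eps_equilibrium ::
  "real \<Rightarrow> real \<Rightarrow> real \<Rightarrow> real \<Rightarrow> real \<Rightarrow> real \<Rightarrow> real \<Rightarrow> real \<Rightarrow> real \<Rightarrow> real \<Rightarrow>
   real measure \<Rightarrow> real measure \<Rightarrow> bool" where
  "bus_eps_equilibrium D T vmin vmax lam p c x0 y0 eps X Y \<longleftrightarrow>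
     eps_equilibrium {vmin..vmax}
       (\<lambda>vx vy. payoff_x D T lam p c x0 vx y0 vy)
       (\<lambda>vx vy. payoff_y D T lam p c x0 vx y0 vy) eps X Y"

definition bus_nash_equilibrium ::
  "real \<Rightarrow> real \<Rightarrow> real \<Rightarrow> real \<Rightarrow> real \<Rightarrow> real \<Rightarrow> real \<Rightarrow> real \<Rightarrow> real \<Rightarrow>
   real measure \<Rightarrow> real measure \<Rightarrow> bool" where
  "bus_nash_equilibrium D T vmin vmax lam p c x0 y0 X Y \<longleftrightarrow>
     bus_eps_equilibrium D T vmin vmax lam p c x0 y0 0 X Y"


section \<open>Finite mixtures of laws\<close>

abbreviation point_mass :: "real \<Rightarrow> real measure" where
  "point_mass v \<equiv> return borel v"

text \<open>For \<open>a < b\<close> this is the uniform law.  For \<open>b \<le> a\<close> it is the null measure; such a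
  component only ever occurs with weight 0.\<close>

definition uniform_on :: "real \<Rightarrow> real \<Rightarrow> real measure" where
  "uniform_on a b = uniform_measure lborel {a<..<b}"

definition mixture :: "(real \<times> real measure) list \<Rightarrow> real measure" where
  "mixture ws = measure_of UNIV (sets borel) (\<lambda>A. \<Sum>(q, M)\<leftarrow>ws. ennreal q * emeasure M A)"

lemma sets_uniform_on [simp, measurable_cong]: "sets (uniform_on a b) = sets borel"
  by (simp add: uniform_on_def)

lemma space_mixture [simp]: "space (mixture ws) = UNIV"
  by (simp add: mixture_def space_measure_of_conv)

lemma sets_mixture [simp, measurable_cong]: "sets (mixture ws) = sets borel"
  unfolding mixture_def by (metis sets.sets_measure_of_eq space_borel)

lemma emeasure_mixture:
  assumes "\<And>q M. (q, M) \<in> set ws \<Longrightarrow> sets M = sets borel" and "A \<in> sets borel"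
  shows "emeasure (mixture ws) A = (\<Sum>(q, M)\<leftarrow>ws. ennreal q * emeasure M A)"
proof (rule emeasure_measure_of[OF mixture_def])
  let ?f = "\<lambda>A. \<Sum>(q, M)\<leftarrow>ws. ennreal q * emeasure M A"
  show "sets borel \<subseteq> Pow (UNIV :: real set)" by simp
  show "A \<in> sets (mixture ws)" using assms(2) by simp
  show "positive (sets (mixture ws)) ?f"
    unfolding positive_def by (induction ws) auto
  have "(\<Sum>i. \<Sum>(q, M)\<leftarrow>ws. ennreal q * emeasure M (F i))
      = (\<Sum>(q, M)\<leftarrow>ws. ennreal q * emeasure M (\<Union>i. F i))"
    if "range F \<subseteq> sets borel" "disjoint_family F" for F :: "nat \<Rightarrow> real set"
    using assms(1)
  proof (induction ws)
    case (Cons w ws)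
    obtain q M where w: "w = (q, M)" by (cases w)
    have "(\<Sum>i. emeasure M (F i)) = emeasure M (\<Union>i. F i)"
      using that Cons.prems w by (intro suminf_emeasure) auto
    moreover have "(\<Sum>i. \<Sum>(q, M)\<leftarrow>ws. ennreal q * emeasure M (F i))
        = (\<Sum>(q, M)\<leftarrow>ws. ennreal q * emeasure M (\<Union>i. F i))"
      using Cons.prems by (intro Cons.IH) auto
    ultimately show ?case
      by (simp add: w flip: suminf_add)
  qed simp
  then show "countably_additive (sets (mixture ws)) ?f"
    unfolding countably_additive_def by auto
qed


section \<open>Measurability and random variables\<close>

lemma borel_measurable_mod_circ [measurable]:
  "mod_circ D \<in> borel_measurable borel"
  unfolding mod_circ_def by measurable

lemma borel_measurable_payoff_x:
  "(\<lambda>(vx, vy). payoff_x D T lam p c x0 vx y0 vy) \<in> borel_measurable (borel \<Otimes>\<^sub>M borel)"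
  unfolding payoff_x_def dist_x_def final_pos_def Let_def by measurable

lemma borel_measurable_payoff_y:
  "(\<lambda>(vx, vy). payoff_y D T lam p c x0 vx y0 vy) \<in> borel_measurable (borel \<Otimes>\<^sub>M borel)"
  unfolding payoff_y_def dist_y_def final_pos_def Let_def by measurable

lemma (in prob_space) expected_payoff_distr:
  fixes X Y :: "'a \<Rightarrow> real"
  assumes "indep_var borel X borel Y"
    and "(\<lambda>(v, w). u v w) \<in> borel_measurable (borel \<Otimes>\<^sub>M borel)"
  shows "expected_payoff u (distr M borel X) (distr M borel Y) = expectation (\<lambda>z. u (X z) (Y z))"
proof -
  have XY: "random_variable borel X" "random_variable borel Y"
    and eq: "distr M borel X \<Otimes>\<^sub>M distr M borel Y = distr M (borel \<Otimes>\<^sub>M borel) (\<lambda>z. (X z, Y z))"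
    using assms(1) unfolding indep_var_distribution_eq by auto
  show ?thesis
    unfolding expected_payoff_def eq
    using XY assms(2) by (subst integral_distr) auto
qed

end

theory Submission
  imports Defs
begin

text \<open>
  The two payoffs always add up to \<open>p\<lambda>D - 2cT\<close>, so the game is a constant-sum game: \<open>\<^bold>x\<close>
  maximizes and \<open>\<^bold>y\<close> minimizes the directed final gap from \<open>\<^bold>x\<close> to \<open>\<^bold>y\<close>.  Since nobody can gain
  \<open>D/2\<close> on the other, this gap is \<open>d0 + T(w - v)\<close>, plus \<open>D\<close> if \<open>\<^bold>x\<close> overtakes \<open>\<^bold>y\<close>, plus \<open>D/2\<close> in
  case of a tie.  In a) and d) the proposed pure pair is a strict saddle point, and in a
  constant-sum game this excludes any other mixed equilibrium.  In b) and c) the expected gap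
  against a mixed strategy depends only on the mean of the law and on the probabilities of
  overtaking and of a tie; the uniform parts have density \<open>T/D\<close>, chosen so that the overtaking
  probability exactly compensates the linear term.
\<close>

section \<open>Constant-sum games with mixed strategies\<close>

lemma mixed_strategiesD:
  assumes "M \<in> mixed_strategies S"
  shows "prob_space M" "sets M = sets borel" "space M = UNIV" "emeasure M S = 1"
  using assms sets_eq_imp_space_eq[of M borel] by (auto simp: mixed_strategies_def)

lemma AE_mixed_strategies:
  assumes "M \<in> mixed_strategies S" "S \<in> sets borel"
  shows "AE v in M. v \<in> S"
proof -
  interpret prob_space M using mixed_strategiesD[OF assms(1)] by simp
  have "prob S = 1" using mixed_strategiesD(4)[OF assms(1)] by (simp add: measure_def)
  then show ?thesis by (rule AE_prob_1)
qed

lemma point_mass_mixed_strategies: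
  assumes "a \<in> S" "S \<in> sets borel"
  shows "point_mass a \<in> mixed_strategies S"
  using assms by (auto simp: mixed_strategies_def intro: prob_space_return)

lemma eq_point_mass:
  fixes M :: "real measure"
  assumes "prob_space M" "sets M = sets borel" "AE v in M. v = a"
  shows "M = point_mass a"
proof (rule measure_eqI)
  interpret prob_space M by fact
  fix A assume A: "A \<in> sets M"
  \<comment> \<open>Since \<open>v = a\<close> almost everywhere, \<open>A\<close> agrees up to a
    null set with the whole space or with the empty set.\<close>
  have "emeasure M A = emeasure M (if a \<in> A then space M else {})"
    using assms(3) A by (intro emeasure_eq_AE) (auto intro: AE_I2)
  then show "emeasure M A = emeasure (point_mass a) A"
    using A assms(2) by (auto simp: emeasure_space_1 split: if_splits)
qed (use assms in simp)

text \<open>Everything is phrased through \<open>ux\<close>: \<open>x\<close> maximizes it and, the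
  sum being constant, \<open>y\<close> minimizes it. The bound is required for all real arguments,
  so integrability against any mixed strategy needs no restriction to \<open>S\<close>.\<close>

locale constant_sum_game =
  fixes S :: "real set" and ux uy :: "real \<Rightarrow> real \<Rightarrow> real" and A B :: real
  assumes S_borel: "S \<in> sets borel"
    and measurable_ux: "(\<lambda>(v, w). ux v w) \<in> borel_measurable (borel \<Otimes>\<^sub>M borel)"
    and bounded_ux: "\<bar>ux v w\<bar> \<le> B"
    and constant_sum: "uy v w = A - ux v w"
begin

section \<open>Integrability, Fubini and bounds on expected payoffs\<close>

lemma ux_measurable_snd: "(\<lambda>w. ux v w) \<in> borel_measurable borel"
proof -
  have "(\<lambda>w. (\<lambda>(v, w). ux v w) (v, w)) \<in> borel_measurable borel"
    by (rule measurable_compose[OF _ measurable_ux]) simp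
  then show ?thesis by simp
qed

lemma ux_measurable_fst: "(\<lambda>v. ux v w) \<in> borel_measurable borel"
proof -
  have "(\<lambda>v. (\<lambda>(v, w). ux v w) (v, w)) \<in> borel_measurable borel"
    by (rule measurable_compose[OF _ measurable_ux]) simp
  then show ?thesis by simp
qed

lemma integrable_ux_snd:
  assumes "M \<in> mixed_strategies S"
  shows "integrable M (\<lambda>w. ux v w)"
proof -
  interpret prob_space M using mixed_strategiesD[OF assms] by simp
  show ?thesis
    using bounded_ux ux_measurable_snd mixed_strategiesD(2)[OF assms]
    by (intro integrable_const_bound[where B = B]) (auto cong: measurable_cong_sets)
qed

lemma integrable_ux_fst:
  assumes "M \<in> mixed_strategies S"
  shows "integrable M (\<lambda>v. ux v w)"
proof -
  interpret prob_space M using mixed_strategiesD[OF assms] by simp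
  show ?thesis
    using bounded_ux ux_measurable_fst mixed_strategiesD(2)[OF assms]
    by (intro integrable_const_bound[where B = B]) (auto cong: measurable_cong_sets)
qed

lemma integrable_ux_pair:
  assumes "X \<in> mixed_strategies S" "Y \<in> mixed_strategies S"
  shows "integrable (X \<Otimes>\<^sub>M Y) (\<lambda>(v, w). ux v w)"
proof -
  interpret X: prob_space X using mixed_strategiesD[OF assms(1)] by simp
  interpret Y: prob_space Y using mixed_strategiesD[OF assms(2)] by simp
  interpret pair_prob_space X Y ..
  have "sets (X \<Otimes>\<^sub>M Y) = sets (borel \<Otimes>\<^sub>M borel)"
    using mixed_strategiesD(2)[OF assms(1)] mixed_strategiesD(2)[OF assms(2)]
    by (intro sets_pair_measure_cong) auto
  then show ?thesis
    using bounded_ux measurable_ux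
    by (intro P.integrable_const_bound[where B = B]) (auto cong: measurable_cong_sets)
qed

text \<open>A bounded measurable payoff is integrable for the product law, so Fubini applies in both
  orders: one order serves deviations of \<open>x\<close>, the other those of
  \<open>y\<close>.\<close>

lemma
  assumes "X \<in> mixed_strategies S" "Y \<in> mixed_strategies S"
  shows expected_payoff_fst: "expected_payoff ux X Y = (\<integral>v. (\<integral>w. ux v w \<partial>Y) \<partial>X)"
    and expected_payoff_snd: "expected_payoff ux X Y = (\<integral>w. (\<integral>v. ux v w \<partial>X) \<partial>Y)"
    and integrable_expected_fst: "integrable X (\<lambda>v. \<integral>w. ux v w \<partial>Y)"
    and integrable_expected_snd: "integrable Y (\<lambda>w. \<integral>v. ux v w \<partial>X)"
    and expected_payoff_uy: "expected_payoff uy X Y = A - expected_payoff ux X Y"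
proof -
  interpret X: prob_space X using mixed_strategiesD[OF assms(1)] by simp
  interpret Y: prob_space Y using mixed_strategiesD[OF assms(2)] by simp
  interpret pair_prob_space X Y ..
  note int = integrable_ux_pair[OF assms]
  show "expected_payoff ux X Y = (\<integral>v. (\<integral>w. ux v w \<partial>Y) \<partial>X)"
    unfolding expected_payoff_def using integral_fst'[OF int] by simp
  show "expected_payoff ux X Y = (\<integral>w. (\<integral>v. ux v w \<partial>X) \<partial>Y)"
    unfolding expected_payoff_def using integral_snd[OF int] by simp
  show "integrable X (\<lambda>v. \<integral>w. ux v w \<partial>Y)"
    using integrable_fst'[OF int] by simp
  show "integrable Y (\<lambda>w. \<integral>v. ux v w \<partial>X)"
    using integrable_snd[OF int] by simp
  have "expected_payoff uy X Y = (\<integral>z. A - (case z of (v, w) \<Rightarrow> ux v w) \<partial>(X \<Otimes>\<^sub>M Y))"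
    unfolding expected_payoff_def by (intro Bochner_Integration.integral_cong) (auto simp: constant_sum)
  then show "expected_payoff uy X Y = A - expected_payoff ux X Y"
    unfolding expected_payoff_def using int by (simp add: P.prob_space)
qed

text \<open>This bound and its three companions reduce the comparison of mixed deviations to pure
  ones: a mixed strategy only averages the payoffs of pure replies.\<close>

lemma expected_payoff_le:
  assumes "X \<in> mixed_strategies S" "Y \<in> mixed_strategies S"
    and "AE v in X. (\<integral>w. ux v w \<partial>Y) \<le> C"
  shows "expected_payoff ux X Y \<le> C"
proof -
  interpret X: prob_space X using mixed_strategiesD[OF assms(1)] by simp
  show ?thesis
    unfolding expected_payoff_fst[OF assms(1,2)]
    using integrable_expected_fst[OF assms(1,2)] assms(3) by (rule X.integral_le_const)
qed

lemma expected_payoff_ge: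
  assumes "X \<in> mixed_strategies S" "Y \<in> mixed_strategies S"
    and "AE v in X. C \<le> (\<integral>w. ux v w \<partial>Y)"
  shows "C \<le> expected_payoff ux X Y"
proof -
  interpret X: prob_space X using mixed_strategiesD[OF assms(1)] by simp
  show ?thesis
    unfolding expected_payoff_fst[OF assms(1,2)]
    using integrable_expected_fst[OF assms(1,2)] assms(3) by (rule X.integral_ge_const)
qed

lemma expected_payoff_le':
  assumes "X \<in> mixed_strategies S" "Y \<in> mixed_strategies S"
    and "AE w in Y. (\<integral>v. ux v w \<partial>X) \<le> C"
  shows "expected_payoff ux X Y \<le> C"
proof -
  interpret Y: prob_space Y using mixed_strategiesD[OF assms(2)] by simp
  show ?thesis
    unfolding expected_payoff_snd[OF assms(1,2)]
    using integrable_expected_snd[OF assms(1,2)] assms(3) by (rule Y.integral_le_const)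
qed

lemma expected_payoff_ge':
  assumes "X \<in> mixed_strategies S" "Y \<in> mixed_strategies S"
    and "AE w in Y. C \<le> (\<integral>v. ux v w \<partial>X)"
  shows "C \<le> expected_payoff ux X Y"
proof -
  interpret Y: prob_space Y using mixed_strategiesD[OF assms(2)] by simp
  show ?thesis
    unfolding expected_payoff_snd[OF assms(1,2)]
    using integrable_expected_snd[OF assms(1,2)] assms(3) by (rule Y.integral_ge_const)
qed

lemma expected_payoff_point_mass_left:
  assumes "a \<in> S" "Y \<in> mixed_strategies S"
  shows "expected_payoff ux (point_mass a) Y = (\<integral>w. ux a w \<partial>Y)"
proof -
  note pm = point_mass_mixed_strategies[OF assms(1) S_borel]
  have "(\<lambda>v. \<integral>w. ux v w \<partial>Y) \<in> borel_measurable borel"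
    using borel_measurable_integrable[OF integrable_expected_fst[OF pm assms(2)]] by simp
  then show ?thesis
    unfolding expected_payoff_fst[OF pm assms(2)] by (simp add: integral_return)
qed

lemma expected_payoff_point_mass_right:
  assumes "X \<in> mixed_strategies S" "b \<in> S"
  shows "expected_payoff ux X (point_mass b) = (\<integral>v. ux v b \<partial>X)"
proof -
  note pm = point_mass_mixed_strategies[OF assms(2) S_borel]
  have "(\<lambda>w. \<integral>v. ux v w \<partial>X) \<in> borel_measurable borel"
    using borel_measurable_integrable[OF integrable_expected_snd[OF assms(1) pm]] by simp
  then show ?thesis
    unfolding expected_payoff_snd[OF assms(1) pm] by (simp add: integral_return)
qed

section \<open>Equilibrium and uniqueness criteria\<close>

text \<open>\<open>C\<close> bounds every pure reply of \<open>x\<close> to \<open>Y\<close>, and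
  almost every speed used by \<open>X\<close> comes within \<open>eps\<close> of it; hence
  \<open>X\<close> earns at least \<open>C - eps\<close> and no deviation earns more than
  \<open>C\<close>. The same holds for \<open>y\<close> with \<open>m\<close>. The constants
  \<open>C\<close> and \<open>m\<close> are independent, so the expected payoff of the pair need not
  be computed.\<close>

lemma eps_equilibriumI:
  assumes X: "X \<in> mixed_strategies S" and Y: "Y \<in> mixed_strategies S"
    and "\<And>v. v \<in> S \<Longrightarrow> (\<integral>w. ux v w \<partial>Y) \<le> C"
    and "AE v in X. C \<le> (\<integral>w. ux v w \<partial>Y) + eps"
    and "\<And>w. w \<in> S \<Longrightarrow> m \<le> (\<integral>v. ux v w \<partial>X)"
    and "AE w in Y. (\<integral>v. ux v w \<partial>X) \<le> m + eps"
  shows "eps_equilibrium S ux uy eps X Y"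
proof -
  have "C - eps \<le> expected_payoff ux X Y"
    using assms(4) by (intro expected_payoff_ge X Y) (auto elim: eventually_mono)
  moreover have "expected_payoff ux X Y \<le> m + eps"
    by (intro expected_payoff_le' X Y assms)
  moreover have "expected_payoff ux X' Y \<le> C" if "X' \<in> mixed_strategies S" for X'
    using AE_mixed_strategies[OF that S_borel] assms(3)
    by (intro expected_payoff_le that Y) (auto elim: eventually_mono)
  moreover have "m \<le> expected_payoff ux X Y'" if "Y' \<in> mixed_strategies S" for Y'
    using AE_mixed_strategies[OF that S_borel] assms(5)
    by (intro expected_payoff_ge' that X) (auto elim: eventually_mono)
  ultimately show ?thesis
    unfolding eps_equilibrium_def using X Y by (fastforce simp: expected_payoff_uy)
qed

lemma eps_equilibrium_saddle:
  assumes "a \<in> S" "b \<in> S"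
    and "\<And>v. v \<in> S \<Longrightarrow> ux v b \<le> ux a b" and "\<And>w. w \<in> S \<Longrightarrow> ux a b \<le> ux a w"
  shows "eps_equilibrium S ux uy 0 (point_mass a) (point_mass b)"
  using assms S_borel ux_measurable_fst ux_measurable_snd
  by (intro eps_equilibriumI[where C = "ux a b" and m = "ux a b"] point_mass_mixed_strategies)
     (auto simp: integral_return AE_return)

text \<open>Deviating to \<open>a\<close> and to \<open>b\<close> sandwiches the equilibrium payoff
  between the mean of \<open>ux a w\<close> under \<open>Y\<close> and that of \<open>ux v b\<close>
  under \<open>X\<close>. The saddle inequalities order these two means the other way round, with
  \<open>ux a b\<close> in between, so both equal \<open>ux a b\<close>. The nonnegative losses then
  have integral 0 and vanish almost everywhere, and strictness leaves only \<open>a\<close> and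
  \<open>b\<close>.\<close>

lemma strict_saddle_unique:
  assumes "a \<in> S" "b \<in> S"
    and row: "\<And>v. v \<in> S \<Longrightarrow> v \<noteq> a \<Longrightarrow> ux v b < ux a b"
    and col: "\<And>w. w \<in> S \<Longrightarrow> w \<noteq> b \<Longrightarrow> ux a b < ux a w"
    and eq: "eps_equilibrium S ux uy 0 X Y"
  shows "X = point_mass a \<and> Y = point_mass b"
proof -
  from eq have X: "X \<in> mixed_strategies S" and Y: "Y \<in> mixed_strategies S"
    and devX: "\<And>X'. X' \<in> mixed_strategies S \<Longrightarrow> expected_payoff ux X' Y \<le> expected_payoff ux X Y"
    and devY: "\<And>Y'. Y' \<in> mixed_strategies S \<Longrightarrow> expected_payoff ux X Y \<le> expected_payoff ux X Y'"
    by (auto simp: eps_equilibrium_def expected_payoff_uy)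
  interpret X: prob_space X using mixed_strategiesD[OF X] by simp
  interpret Y: prob_space Y using mixed_strategiesD[OF Y] by simp
  have le: "(\<integral>w. ux a w \<partial>Y) \<le> (\<integral>v. ux v b \<partial>X)"
    using devX[OF point_mass_mixed_strategies[OF \<open>a \<in> S\<close> S_borel]]
      devY[OF point_mass_mixed_strategies[OF \<open>b \<in> S\<close> S_borel]]
    by (simp add: expected_payoff_point_mass_left expected_payoff_point_mass_right assms X Y)
  have rowX: "AE v in X. ux v b \<le> ux a b"
    using AE_mixed_strategies[OF X S_borel] by eventually_elim (metis row less_eq_real_def)
  have colY: "AE w in Y. ux a b \<le> ux a w"
    using AE_mixed_strategies[OF Y S_borel] by eventually_elim (metis col less_eq_real_def)
  have "(\<integral>v. ux v b \<partial>X) \<le> ux a b"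
    using rowX by (intro X.integral_le_const integrable_ux_fst X)
  moreover have "ux a b \<le> (\<integral>w. ux a w \<partial>Y)"
    using colY by (intro Y.integral_ge_const integrable_ux_snd Y)
  ultimately have int: "(\<integral>v. ux v b \<partial>X) = ux a b" "(\<integral>w. ux a w \<partial>Y) = ux a b"
    using le by auto
  have "AE v in X. ux a b - ux v b = 0"
    using rowX int integrable_ux_fst[OF X]
    by (subst integral_nonneg_eq_0_iff_AE[symmetric]) (auto simp: X.prob_space)
  with AE_mixed_strategies[OF X S_borel] have "AE v in X. v = a"
    by eventually_elim (use row in force)
  moreover have "AE w in Y. ux a w - ux a b = 0"
    using colY int integrable_ux_snd[OF Y]
    by (subst integral_nonneg_eq_0_iff_AE[symmetric]) (auto simp: Y.prob_space)
  with AE_mixed_strategies[OF Y S_borel] have "AE w in Y. w = b"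
    by eventually_elim (use col in force)
  ultimately show ?thesis
    using mixed_strategiesD(2)[OF X] mixed_strategiesD(2)[OF Y]
    by (auto intro: eq_point_mass X.prob_space_axioms Y.prob_space_axioms)
qed

end


section \<open>Mixtures and uniform laws\<close>

text \<open>Only components of nonzero weight are constrained, because a degenerate uniform
  component is the null measure and may occur with weight 0.\<close>

lemma emeasure_mixture_eq_1:
  assumes "\<And>q M. (q, M) \<in> set ws \<Longrightarrow> sets M = sets borel \<and> 0 \<le> q \<and> (q \<noteq> 0 \<longrightarrow> emeasure M A = 1)"
    and "A \<in> sets borel" and "(\<Sum>(q, M)\<leftarrow>ws. q) = 1"
  shows "emeasure (mixture ws) A = 1"
proof -
  \<comment> \<open>Nonnegativity of the partial sum is carried along because \<open>ennreal\<close>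
    is additive only on nonnegative reals.\<close>
  have "(\<Sum>(q, M)\<leftarrow>ws. ennreal q * emeasure M A) = ennreal (\<Sum>(q, M)\<leftarrow>ws. q) \<and>
      0 \<le> (\<Sum>(q, M)\<leftarrow>ws. q)"
    using assms(1)
  proof (induction ws)
    case (Cons w ws)
    obtain q M where w: "w = (q, M)" by (cases w)
    have "ennreal q * emeasure M A = ennreal q" "0 \<le> q"
      using Cons.prems[of q M] w by (cases "q = 0"; auto)+
    moreover have "(\<Sum>(q, M)\<leftarrow>ws. ennreal q * emeasure M A) = ennreal (\<Sum>(q, M)\<leftarrow>ws. q) \<and>
        0 \<le> (\<Sum>(q, M)\<leftarrow>ws. q)"
      using Cons.prems by (intro Cons.IH) auto
    ultimately show ?case by (simp add: w ennreal_plus)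
  qed simp
  with assms show ?thesis by (subst emeasure_mixture) auto
qed

lemma mixture_mixed_strategies:
  assumes "\<And>q M. (q, M) \<in> set ws \<Longrightarrow>
      sets M = sets borel \<and> 0 \<le> q \<and> (q \<noteq> 0 \<longrightarrow> M \<in> mixed_strategies S)"
    and "S \<in> sets borel" and "(\<Sum>(q, M)\<leftarrow>ws. q) = 1"
  shows "mixture ws \<in> mixed_strategies S"
proof -
  \<comment> \<open>\<open>A = UNIV\<close> gives a probability space, \<open>A = S\<close> the
    concentration on \<open>S\<close>.\<close>
  have "emeasure (mixture ws) A = 1" if "A = S \<or> A = UNIV" for A
  proof (rule emeasure_mixture_eq_1[OF _ _ assms(3)])
    fix q M assume "(q, M) \<in> set ws"
    then have M: "sets M = sets borel" "0 \<le> q" "q \<noteq> 0 \<Longrightarrow> M \<in> mixed_strategies S"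
      using assms(1) by blast+
    have "emeasure M A = 1" if "q \<noteq> 0"
    proof -
      note MS = mixed_strategiesD[OF M(3)[OF that]]
      show ?thesis
        using \<open>A = S \<or> A = UNIV\<close>
      proof
        show ?thesis if "A = UNIV"
          using prob_space.emeasure_space_1[OF MS(1)] unfolding MS(3) that .
      qed (simp only: MS(4))
    qed
    with M(1,2) show "sets M = sets borel \<and> 0 \<le> q \<and> (q \<noteq> 0 \<longrightarrow> emeasure M A = 1)"
      by blast
  next
    show "A \<in> sets borel" using that by (rule disjE) (simp_all add: assms(2))
  qed
  then have "emeasure (mixture ws) S = 1" "emeasure (mixture ws) UNIV = 1" by blast+
  then show ?thesis
    unfolding mixed_strategies_def by (simp add: prob_spaceI)
qed

lemma measure_mixture:
  assumes "\<And>q M. (q, M) \<in> set ws \<Longrightarrow> sets M = sets borel \<and> finite_measure M \<and> 0 \<le> q"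
    and "A \<in> sets borel"
  shows "measure (mixture ws) A = (\<Sum>(q, M)\<leftarrow>ws. q * measure M A)"
proof -
  have "(\<Sum>(q, M)\<leftarrow>ws. ennreal q * emeasure M A) = ennreal (\<Sum>(q, M)\<leftarrow>ws. q * measure M A) \<and>
      0 \<le> (\<Sum>(q, M)\<leftarrow>ws. q * measure M A)"
    using assms(1)
  proof (induction ws)
    case (Cons w ws)
    obtain q M where w: "w = (q, M)" by (cases w)
    have "finite_measure M" "0 \<le> q" using Cons.prems[of q M] w by auto
    then have "ennreal q * emeasure M A = ennreal (q * measure M A)"
      by (simp add: finite_measure.emeasure_eq_measure ennreal_mult)
    moreover have "(\<Sum>(q, M)\<leftarrow>ws. ennreal q * emeasure M A) =
        ennreal (\<Sum>(q, M)\<leftarrow>ws. q * measure M A) \<and> 0 \<le> (\<Sum>(q, M)\<leftarrow>ws. q * measure M A)"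
      using Cons.prems by (intro Cons.IH) auto
    ultimately show ?case using \<open>0 \<le> q\<close> by (simp add: w ennreal_plus)
  qed simp
  with assms show ?thesis
    by (simp add: measure_def emeasure_mixture[of ws A])
qed

lemma AE_mixture:
  assumes "\<And>q M. (q, M) \<in> set ws \<Longrightarrow> sets M = sets borel \<and> 0 \<le> q \<and> (q \<noteq> 0 \<longrightarrow> emeasure M A = 1)"
    and "mixture ws \<in> mixed_strategies S" and "A \<in> sets borel" and "(\<Sum>(q, M)\<leftarrow>ws. q) = 1"
  shows "AE v in mixture ws. v \<in> A"
proof -
  interpret prob_space "mixture ws" using mixed_strategiesD[OF assms(2)] by simp
  have "prob A = 1"
    using emeasure_mixture_eq_1[OF assms(1,3,4)] by (simp add: measure_def)
  then show ?thesis by (rule AE_prob_1)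
qed

section \<open>Uniform laws\<close>

lemma emeasure_uniform_on_eq_1:
  assumes "a < b" "{a<..<b} \<subseteq> A" "A \<in> sets borel"
  shows "emeasure (uniform_on a b) A = 1"
proof -
  have "{a<..<b} \<inter> A = {a<..<b}" using assms by auto
  then show ?thesis
    using assms by (simp add: uniform_on_def emeasure_uniform_measure divide_ennreal)
qed

lemma prob_space_uniform_on:
  assumes "a < b"
  shows "prob_space (uniform_on a b)"
  using assms unfolding uniform_on_def by (intro prob_space_uniform_measure) auto

lemma uniform_on_mixed_strategies:
  assumes "a < b" "{a<..<b} \<subseteq> S" "S \<in> sets borel"
  shows "uniform_on a b \<in> mixed_strategies S"
  using assms prob_space_uniform_on emeasure_uniform_on_eq_1 by (auto simp: mixed_strategies_def)

lemma measure_uniform_on: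
  assumes "a < b" "A \<in> sets borel"
  shows "measure (uniform_on a b) A = measure lborel ({a<..<b} \<inter> A) / (b - a)"
  using assms unfolding uniform_on_def by (subst measure_uniform_measure) auto

text \<open>Half-lines are the overtaking events and singletons the ties, so this and the next two
  lemmas supply the uniform contributions to the expected gaps.\<close>

lemma measure_uniform_on_lessThan:
  assumes "a < b"
  shows "measure (uniform_on a b) {..<z} = (if z \<le> a then 0 else if z \<le> b then (z - a) / (b - a) else 1)"
proof -
  have "{a<..<b} \<inter> {..<z} = (if z \<le> a then {} else if z \<le> b then {a<..<z} else {a<..<b})"
    by auto
  with assms show ?thesis by (simp add: measure_uniform_on)
qed

lemma measure_uniform_on_greaterThan:
  assumes "a < b"
  shows "measure (uniform_on a b) {z<..} = (if z \<le> a then 1 else if z \<le> b then (b - z) / (b - a) else 0)"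
proof -
  have "{a<..<b} \<inter> {z<..} = (if z \<le> a then {a<..<b} else if z \<le> b then {z<..<b} else {})"
    by auto
  with assms show ?thesis by (simp add: measure_uniform_on)
qed

lemma measure_uniform_on_singleton:
  assumes "a < b"
  shows "measure (uniform_on a b) {z} = 0"
proof -
  have "{a<..<b} \<inter> {z} = (if a < z \<and> z < b then {z} else {})" by auto
  with assms show ?thesis by (simp add: measure_uniform_on)
qed

lemma measure_point_mass:
  assumes "A \<in> sets borel"
  shows "measure (point_mass a) A = indicator A a"
  using assms by (simp add: measure_return)


section \<open>The bus game\<close>

lemma mod_circ_bounds:
  assumes "D > 0"
  shows "0 \<le> mod_circ D r" "mod_circ D r < D"
proof -
  have "0 \<le> r / D - of_int \<lfloor>r / D\<rfloor>" "r / D - of_int \<lfloor>r / D\<rfloor> < 1" by linarith+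
  with assms show "0 \<le> mod_circ D r" "mod_circ D r < D"
    unfolding mod_circ_def by (auto simp: mult_less_cancel_left2)
qed

lemma mod_circ_eq:
  assumes "D > 0"
  shows "\<exists>k::int. mod_circ D r = r + D * of_int k"
  using assms by (intro exI[of _ "- \<lfloor>r / D\<rfloor>"]) (simp add: mod_circ_def field_simps)

text \<open>The directed distance is congruent to \<open>z\<close> modulo \<open>D\<close> and lies
  in \<open>[0, D)\<close>. With \<open>z\<close> in \<open>(-D, D)\<close>, at most one full turn
  has to be added.\<close>

lemma dist_x_mod_circ:
  assumes "D > 0" "b - a = z + D * of_int k" "- D < z" "z < D"
  shows "dist_x D (mod_circ D a) (mod_circ D b) = (if 0 \<le> z then z else D + z)"
proof -
  let ?e = "dist_x D (mod_circ D a) (mod_circ D b)"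
  obtain i j :: int where "mod_circ D a = a + D * i" "mod_circ D b = b + D * j"
    using mod_circ_eq[OF assms(1)] by metis
  then have "?e = z + D * of_int (k + j - i + (if mod_circ D a \<le> mod_circ D b then 0 else 1))"
    using assms(2) by (auto simp: dist_x_def algebra_simps)
  then obtain n :: int where n: "?e = z + D * of_int n" by blast
  have "0 \<le> ?e" "?e < D"
    using mod_circ_bounds[OF assms(1), of a] mod_circ_bounds[OF assms(1), of b]
    by (auto simp: dist_x_def)
  \<comment> \<open>This leaves \<open>n\<close> strictly between -1 and 1 if \<open>z\<close> is
    nonnegative, and strictly between 0 and 2 otherwise.\<close>
  then have "D * of_int n < D * (if 0 \<le> z then 1 else 2)"
    "D * (if 0 \<le> z then -1 else 0) < D * of_int n"
    unfolding n using assms(3,4) by (cases "0 \<le> z"; simp only: if_True if_False; linarith)+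
  then have "real_of_int n < (if 0 \<le> z then 1 else 2)" "(if 0 \<le> z then -1 else 0) < real_of_int n"
    using assms(1) by (simp_all only: mult_less_cancel_left_pos)
  then have "n = (if 0 \<le> z then 0 else 1)" by (cases "0 \<le> z") auto
  then show ?thesis unfolding n by simp
qed

lemma dist_y_eq: "x \<noteq> y \<Longrightarrow> dist_y D x y = D - dist_x D x y"
  by (auto simp: dist_x_def dist_y_def)

lemma mod_circ_eq_iff_dist_x:
  assumes "D > 0"
  shows "mod_circ D a = mod_circ D b \<longleftrightarrow> dist_x D (mod_circ D a) (mod_circ D b) = 0"
  using mod_circ_bounds[OF assms, of a] mod_circ_bounds[OF assms, of b] by (auto simp: dist_x_def)

text \<open>The choice of \<open>x\<close> as the player with the shorter directed distance enters
  as \<open>d0 <= D / 2\<close>: for distinct positions the two directed distances add up to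
  \<open>D\<close>.\<close>

locale bus_game =
  fixes D T vmin vmax lam p c x0 y0 d0 :: real
  assumes D: "D > 0" and T: "T > 0" and vmin: "0 < vmin" and v_le: "vmin \<le> vmax"
    and lam: "lam > 0" and p: "p \<ge> 0" and vmax: "T * vmax < D / 2"
    and x0: "0 \<le> x0" "x0 < D" and y0: "0 \<le> y0" "y0 < D"
    and d0: "d0 = dist_x D x0 y0" and d0_le: "d0 \<le> D / 2"
begin

abbreviation "ux v w \<equiv> payoff_x D T lam p c x0 v y0 w"
abbreviation "uy v w \<equiv> payoff_y D T lam p c x0 v y0 w"

lemma d0_nonneg: "0 \<le> d0"
  using x0 y0 by (auto simp: d0 dist_x_def)

lemma d_less: "T * (vmax - vmin) < D / 2"
proof -
  have "0 < T * vmin" using T vmin by simp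
  then show ?thesis using vmax by (simp add: algebra_simps)
qed

section \<open>The final gap as a function of the speeds\<close>

text \<open>At a tie the linear part vanishes and \<open>D / 2\<close> remains, as in the payoff.
  The thresholds are stated for the speed \<open>w\<close>, so that overtaking and tie become a
  half-line and a point for the law of \<open>y\<close>.\<close>

definition gap :: "real \<Rightarrow> real \<Rightarrow> real" where
  "gap v w = d0 + T * (w - v)
     + (if w < v - d0 / T then D else if w = v - d0 / T then D / 2 else 0)"

lemma payoff_x_eq:
  assumes "v \<in> {vmin..vmax}" "w \<in> {vmin..vmax}"
  shows "ux v w = p * lam * gap v w - c * T"
proof -
  define z where "z = d0 + T * (w - v)"
  have "\<bar>w - v\<bar> \<le> vmax - vmin" using assms by auto
  then have "\<bar>T * (w - v)\<bar> \<le> T * (vmax - vmin)" using T by (simp add: abs_mult)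
  then have z: "- D < z" "z < D"
    unfolding z_def using d_less d0_nonneg d0_le by linarith+
  \<comment> \<open>The summand -1 undoes the turn that \<open>dist_x\<close> adds to
    \<open>d0\<close> when \<open>x0 > y0\<close>.\<close>
  have "(y0 + T * w) - (x0 + T * v) = z + D * of_int (if x0 \<le> y0 then 0 else -1)"
    by (auto simp: z_def d0 dist_x_def algebra_simps)
  from dist_x_mod_circ[OF D this z]
  have e: "dist_x D (final_pos D T x0 v) (final_pos D T y0 w) = (if 0 \<le> z then z else D + z)"
    unfolding final_pos_def .
  have iff: "final_pos D T x0 v = final_pos D T y0 w \<longleftrightarrow> z = 0"
    using e z mod_circ_eq_iff_dist_x[OF D] unfolding final_pos_def by auto
  have "w < v - d0 / T \<longleftrightarrow> z < 0" "w = v - d0 / T \<longleftrightarrow> z = 0"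
    unfolding z_def using T by (auto simp: field_simps)
  then show ?thesis
    using e iff unfolding payoff_x_def Let_def by (auto simp: gap_def z_def algebra_simps)
qed

text \<open>Two distinct final positions cut the circuit into arcs of total length \<open>D\<close>;
  at a tie the two halves \<open>D / 2\<close> have the same total.\<close>

lemma payoff_const_sum: "uy v w = (p * lam * D - 2 * c * T) - ux v w"
  unfolding payoff_x_def payoff_y_def Let_def by (auto simp: dist_y_eq algebra_simps)

sublocale constant_sum_game "{vmin..vmax}" ux uy "p * lam * D - 2 * c * T" "p * lam * D + \<bar>c * T\<bar>"
proof
  fix v w
  have "0 \<le> p * lam" using p lam by simp
  then have "0 \<le> p * lam * q \<and> p * lam * q \<le> p * lam * D" if "0 \<le> q" "q \<le> D" for q
    using that by (simp add: mult_left_mono)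
  moreover have "0 \<le> dist_x D (final_pos D T x0 v) (final_pos D T y0 w)"
    "dist_x D (final_pos D T x0 v) (final_pos D T y0 w) \<le> D"
    using mod_circ_bounds[OF D, of "x0 + T * v"] mod_circ_bounds[OF D, of "y0 + T * w"]
    by (auto simp: dist_x_def final_pos_def)
  moreover have "0 \<le> D / 2" "D / 2 \<le> D" using D by auto
  \<comment> \<open>\<open>q\<close> is the final directed distance, or \<open>D / 2\<close> at a
    tie.\<close>
  ultimately obtain q where "ux v w = p * lam * q - c * T" "0 \<le> p * lam * q" "p * lam * q \<le> p * lam * D"
    unfolding payoff_x_def Let_def by metis
  then show "\<bar>ux v w\<bar> \<le> p * lam * D + \<bar>c * T\<bar>" by linarith
  show "uy v w = (p * lam * D - 2 * c * T) - ux v w" by (rule payoff_const_sum)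
qed (use borel_measurable_payoff_x in auto)

lemma integrable_mixed:
  assumes "M \<in> mixed_strategies {vmin..vmax}"
  shows "integrable M (\<lambda>v. v)"
proof -
  interpret prob_space M using mixed_strategiesD[OF assms] by simp
  have "AE v in M. norm v \<le> vmax"
    using AE_mixed_strategies[OF assms borel_closed[OF closed_atLeastAtMost]]
    by eventually_elim (use vmin in auto)
  then show ?thesis
    using mixed_strategiesD(2)[OF assms]
    by (intro integrable_const_bound) (auto cong: measurable_cong_sets)
qed

section \<open>Expected gaps against a mixed strategy\<close>

text \<open>The expected \<open>gap\<close> when its second argument is drawn from \<open>M\<close>;
  \<open>gap_fst\<close> averages the first. Only the mean, one half-line and one atom of the law
  matter.\<close>

definition gap_snd :: "real measure \<Rightarrow> real \<Rightarrow> real" where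
  "gap_snd M v = d0 + T * ((\<integral>w. w \<partial>M) - v)
     + (D * measure M {..<v - d0 / T} + D / 2 * measure M {v - d0 / T})"

definition gap_fst :: "real measure \<Rightarrow> real \<Rightarrow> real" where
  "gap_fst M w = d0 + T * (w - (\<integral>v. v \<partial>M))
     + (D * measure M {w + d0 / T<..} + D / 2 * measure M {w + d0 / T})"

lemma integral_payoff_snd:
  assumes M: "M \<in> mixed_strategies {vmin..vmax}" and v: "v \<in> {vmin..vmax}"
  shows "(\<integral>w. ux v w \<partial>M) = p * lam * gap_snd M v - c * T"
proof -
  interpret prob_space M using mixed_strategiesD[OF M] by simp
  note [simp] = mixed_strategiesD(2,3)[OF M] integrable_mixed[OF M]
  have [measurable_cong]: "sets M = sets borel" and [simp]: "prob UNIV = 1"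
    using prob_space by simp_all
  have "(\<integral>w. ux v w \<partial>M) = (\<integral>w. p * lam * (d0 + T * (w - v)
      + D * indicator {..<v - d0 / T} w + D / 2 * indicator {v - d0 / T} w) - c * T \<partial>M)"
  \<comment> \<open>The gap formula holds only for admissible speeds, hence almost
    everywhere.\<close>
  proof (rule integral_cong_AE)
    show "(\<lambda>w. ux v w) \<in> borel_measurable M"
      using borel_measurable_integrable[OF integrable_ux_snd[OF M]] .
    show "AE w in M. ux v w = p * lam * (d0 + T * (w - v)
      + D * indicator {..<v - d0 / T} w + D / 2 * indicator {v - d0 / T} w) - c * T"
      using AE_mixed_strategies[OF M borel_closed[OF closed_atLeastAtMost]]
      by eventually_elim (use v in \<open>auto simp: payoff_x_eq gap_def indicator_def\<close>)
  qed measurable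
  also have "\<dots> = p * lam * gap_snd M v - c * T"
    unfolding gap_snd_def
    by (simp add: prob_space less_top[symmetric])
  finally show ?thesis .
qed

lemma integral_payoff_fst:
  assumes M: "M \<in> mixed_strategies {vmin..vmax}" and w: "w \<in> {vmin..vmax}"
  shows "(\<integral>v. ux v w \<partial>M) = p * lam * gap_fst M w - c * T"
proof -
  interpret prob_space M using mixed_strategiesD[OF M] by simp
  note [simp] = mixed_strategiesD(2,3)[OF M] integrable_mixed[OF M]
  have [measurable_cong]: "sets M = sets borel" and [simp]: "prob UNIV = 1"
    using prob_space by simp_all
  have "(\<integral>v. ux v w \<partial>M) = (\<integral>v. p * lam * (d0 + T * (w - v)
      + D * indicator {w + d0 / T<..} v + D / 2 * indicator {w + d0 / T} v) - c * T \<partial>M)"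
  proof (rule integral_cong_AE)
    show "(\<lambda>v. ux v w) \<in> borel_measurable M"
      using borel_measurable_integrable[OF integrable_ux_fst[OF M]] .
    show "AE v in M. ux v w = p * lam * (d0 + T * (w - v)
      + D * indicator {w + d0 / T<..} v + D / 2 * indicator {w + d0 / T} v) - c * T"
      using AE_mixed_strategies[OF M borel_closed[OF closed_atLeastAtMost]]
      by eventually_elim (use w in \<open>auto simp: payoff_x_eq gap_def indicator_def\<close>)
  qed measurable
  also have "\<dots> = p * lam * gap_fst M w - c * T"
    unfolding gap_fst_def
    by (simp add: prob_space less_top[symmetric])
  finally show ?thesis .
qed

text \<open>Payoffs are the gap scaled by \<open>p * lam\<close> and shifted, so a tolerance
  \<open>eps\<close> in length becomes \<open>p * lam * eps\<close>. For \<open>p = 0\<close>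
  payoffs are constant and nothing has to be checked; the conditions are therefore guarded by
  \<open>p > 0\<close>.\<close>

lemma eps_equilibrium_gapI:
  assumes X: "X \<in> mixed_strategies {vmin..vmax}" and Y: "Y \<in> mixed_strategies {vmin..vmax}"
    and "0 \<le> eps"
    and C: "\<And>v. p > 0 \<Longrightarrow> v \<in> {vmin..vmax} \<Longrightarrow> gap_snd Y v \<le> C"
      "p > 0 \<Longrightarrow> AE v in X. C \<le> gap_snd Y v + eps"
    and m: "\<And>w. p > 0 \<Longrightarrow> w \<in> {vmin..vmax} \<Longrightarrow> m \<le> gap_fst X w"
      "p > 0 \<Longrightarrow> AE w in Y. gap_fst X w \<le> m + eps"
  shows "bus_eps_equilibrium D T vmin vmax lam p c x0 y0 (p * lam * eps) X Y"
proof -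
  let ?r = "\<lambda>z. p * lam * z - c * T"
  have mono: "?r a \<le> ?r b" if "p > 0 \<Longrightarrow> a \<le> b" for a b
    using that lam p by (cases "p = 0") (auto intro: mult_left_mono)
  have shift: "?r a + p * lam * eps = ?r (a + eps)" for a by (simp add: algebra_simps)
  note AEs = AE_mixed_strategies[OF _ S_borel]
  show ?thesis
    unfolding bus_eps_equilibrium_def
  proof (rule eps_equilibriumI[OF X Y, where C = "?r C" and m = "?r m"])
    show "(\<integral>w. ux v w \<partial>Y) \<le> ?r C" if "v \<in> {vmin..vmax}" for v
      unfolding integral_payoff_snd[OF Y that] using C(1)[OF _ that] by (rule mono)
    show "?r m \<le> (\<integral>v. ux v w \<partial>X)" if "w \<in> {vmin..vmax}" for w
      unfolding integral_payoff_fst[OF X that] using m(1)[OF _ that] by (rule mono)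
    have "AE v in X. p > 0 \<longrightarrow> C \<le> gap_snd Y v + eps"
      using C(2) by (cases "p > 0") auto
    with AEs[OF X] show "AE v in X. ?r C \<le> (\<integral>w. ux v w \<partial>Y) + p * lam * eps"
      by eventually_elim (simp only: integral_payoff_snd[OF Y] shift, intro mono, blast)
    have "AE w in Y. p > 0 \<longrightarrow> gap_fst X w \<le> m + eps"
      using m(2) by (cases "p > 0") auto
    with AEs[OF Y] show "AE w in Y. (\<integral>v. ux v w \<partial>X) \<le> ?r m + p * lam * eps"
      by eventually_elim (simp only: integral_payoff_fst[OF X] shift, intro mono, blast)
  qed
qed

section \<open>Pure equilibria\<close>

text \<open>Strictness of the gap passes to the payoffs only if \<open>p > 0\<close>. If
  \<open>vmin = vmax\<close> there is no other speed to compare with, and uniqueness holds for that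
  reason.\<close>

lemma nash_equilibrium_saddle:
  assumes a: "a \<in> {vmin..vmax}" and b: "b \<in> {vmin..vmax}"
    and row: "\<And>v. v \<in> {vmin..vmax} \<Longrightarrow> v \<noteq> a \<Longrightarrow> gap v b < gap a b"
    and col: "\<And>w. w \<in> {vmin..vmax} \<Longrightarrow> w \<noteq> b \<Longrightarrow> gap a b < gap a w"
  shows "bus_nash_equilibrium D T vmin vmax lam p c x0 y0 (point_mass a) (point_mass b)"
    and "\<And>X Y. p > 0 \<or> vmin = vmax \<Longrightarrow> bus_nash_equilibrium D T vmin vmax lam p c x0 y0 X Y \<Longrightarrow>
      X = point_mass a \<and> Y = point_mass b"
proof -
  have K: "0 \<le> p * lam" using p lam by simp
  have "gap v b \<le> gap a b" if "v \<in> {vmin..vmax}" for v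
    using row[OF that] by (cases "v = a") auto
  moreover have "gap a b \<le> gap a w" if "w \<in> {vmin..vmax}" for w
    using col[OF that] by (cases "w = b") auto
  ultimately show "bus_nash_equilibrium D T vmin vmax lam p c x0 y0 (point_mass a) (point_mass b)"
    unfolding bus_nash_equilibrium_def bus_eps_equilibrium_def
    using a b K by (intro eps_equilibrium_saddle) (auto simp: payoff_x_eq intro!: mult_left_mono)
  fix X Y
  assume "p > 0 \<or> vmin = vmax" and eq: "bus_nash_equilibrium D T vmin vmax lam p c x0 y0 X Y"
  then have K: "0 < p * lam \<or> vmin = vmax" using lam by auto
  have "ux v b < ux a b" if "v \<in> {vmin..vmax}" "v \<noteq> a" for v
    using row[OF that] that K a b by (auto simp: payoff_x_eq intro!: mult_strict_left_mono)
  moreover have "ux a b < ux a w" if "w \<in> {vmin..vmax}" "w \<noteq> b" for w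
    using col[OF that] that K a b by (auto simp: payoff_x_eq intro!: mult_strict_left_mono)
  ultimately show "X = point_mass a \<and> Y = point_mass b"
    using eq unfolding bus_nash_equilibrium_def bus_eps_equilibrium_def
    by (intro strict_saddle_unique[OF a b]) auto
qed

text \<open>From a common start, the tie at full speed has gap \<open>D / 2\<close>. A slower
  \<open>x\<close> reaches only \<open>T * (vmax - v) < D / 2\<close>; a slower \<open>y\<close> is
  overtaken and leaves \<open>D - T * (vmax - w) > D / 2\<close>.\<close>

lemma nash_equilibrium_vmax:
  assumes "d0 = 0"
  shows "bus_nash_equilibrium D T vmin vmax lam p c x0 y0 (point_mass vmax) (point_mass vmax)"
    and "\<And>X Y. p > 0 \<or> vmin = vmax \<Longrightarrow> bus_nash_equilibrium D T vmin vmax lam p c x0 y0 X Y \<Longrightarrow>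
      X = point_mass vmax \<and> Y = point_mass vmax"
proof -
  have less: "T * (vmax - v) < D / 2" if "v \<in> {vmin..vmax}" for v
  proof -
    have "T * (vmax - v) \<le> T * (vmax - vmin)" using that T by (intro mult_left_mono) auto
    then show ?thesis using d_less by linarith
  qed
  have row: "gap v vmax < gap vmax vmax" if "v \<in> {vmin..vmax}" "v \<noteq> vmax" for v
    using less[OF that(1)] that unfolding gap_def by (auto simp: assms)
  have "gap vmax vmax < gap vmax w" if "w \<in> {vmin..vmax}" "w \<noteq> vmax" for w
    using less[OF that(1)] that unfolding gap_def by (auto simp: assms algebra_simps)
  note saddle = nash_equilibrium_saddle[OF _ _ row this]
  show "bus_nash_equilibrium D T vmin vmax lam p c x0 y0 (point_mass vmax) (point_mass vmax)"
    using v_le by (intro saddle) auto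
  show "X = point_mass vmax \<and> Y = point_mass vmax"
    if "p > 0 \<or> vmin = vmax" "bus_nash_equilibrium D T vmin vmax lam p c x0 y0 X Y" for X Y
    using v_le by (intro saddle that) auto
qed

text \<open>The head start cannot be made up, so the gap is linear: decreasing in the speed of
  \<open>x\<close> and increasing in that of \<open>y\<close>. Both players slow down.\<close>

lemma nash_equilibrium_vmin:
  assumes "T * (vmax - vmin) < d0"
  shows "bus_nash_equilibrium D T vmin vmax lam p c x0 y0 (point_mass vmin) (point_mass vmin)"
    and "\<And>X Y. p > 0 \<or> vmin = vmax \<Longrightarrow> bus_nash_equilibrium D T vmin vmax lam p c x0 y0 X Y \<Longrightarrow>
      X = point_mass vmin \<and> Y = point_mass vmin"
proof -
  have "vmax - vmin < d0 / T" using assms T by (simp add: field_simps)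
  then have gap: "gap v w = d0 + T * (w - v)" if "v \<in> {vmin..vmax}" "w \<in> {vmin..vmax}" for v w
    using that by (auto simp: gap_def)
  have row: "gap v vmin < gap vmin vmin" if "v \<in> {vmin..vmax}" "v \<noteq> vmin" for v
    using that T by (auto simp: gap mult_less_0_iff)
  have "gap vmin vmin < gap vmin w" if "w \<in> {vmin..vmax}" "w \<noteq> vmin" for w
    using that T by (auto simp: gap)
  note saddle = nash_equilibrium_saddle[OF _ _ row this]
  show "bus_nash_equilibrium D T vmin vmax lam p c x0 y0 (point_mass vmin) (point_mass vmin)"
    using v_le by (intro saddle) auto
  show "X = point_mass vmin \<and> Y = point_mass vmin"
    if "p > 0 \<or> vmin = vmax" "bus_nash_equilibrium D T vmin vmax lam p c x0 y0 X Y" for X Y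
    using v_le by (intro saddle that) auto
qed

section \<open>Mixed eps-equilibria\<close>

text \<open>Let \<open>p > 0\<close>. Against \<open>Y\<close>, a speed just above
  \<open>vmin + d0 / T\<close> costs \<open>x\<close> the length \<open>d0\<close> and wins
  \<open>D\<close> with probability \<open>d0 / D\<close>; beyond it, the density
  \<open>T / D\<close> pays back every further loss, so \<open>x\<close> is indifferent to
  \<open>vmin\<close>. Against \<open>X\<close>, the same density makes \<open>y\<close> indifferent
  up to \<open>vmax - d0 / T\<close>. The remaining mass of \<open>Y\<close> sits
  \<open>eps / T\<close> higher, where \<open>x\<close> can neither pass nor tie, at a cost of
  \<open>eps\<close>.\<close>

lemma eps_equilibrium_mixed:
  assumes d0_pos: "0 < d0" and d0_less: "d0 < T * (vmax - vmin)"
    and q: "0 \<le> q1" "0 \<le> q2" "q1 + q2 = T * (vmax - vmin) / D" "q2 \<le> (T * (vmax - vmin) - d0) / D"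
      "p > 0 \<Longrightarrow> (T * (vmax - vmin) - d0) / D \<le> q2"
    and eps: "0 < eps" "eps \<le> d0"
  shows "bus_eps_equilibrium D T vmin vmax lam p c x0 y0 (p * lam * eps)
    (mixture
      [(1 - (T * (vmax - vmin) - d0) / D, point_mass vmin),
       ((T * (vmax - vmin) - d0) / D, uniform_on (vmin + d0 / T) vmax)])
    (mixture
      [(q1, point_mass vmin),
       (q2, uniform_on (vmax - d0 / T - q2 * D / T) (vmax - d0 / T)),
       (1 - T * (vmax - vmin) / D, point_mass (vmax - d0 / T + eps / T))])"
proof -
  \<comment> \<open>\<open>e\<close> is the head start converted into speed, \<open>l\<close> the
    length of the range of speeds with which \<open>x\<close> can overtake a \<open>y\<close>
    driving at \<open>vmin\<close>.\<close>
  define e where "e = d0 / T"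
  define l where "l = vmax - vmin - e"
  define a where "a = vmax - e - q2 * D / T"
  define u where "u = vmax - e + eps / T"
  define X where "X = mixture [(1 - T * l / D, point_mass vmin), (T * l / D, uniform_on (vmin + e) vmax)]"
  define Y where "Y = mixture [(q1, point_mass vmin), (q2, uniform_on a (vmax - e)),
     (1 - T * (vmax - vmin) / D, point_mass u)]"
  have e: "0 < e" "d0 = T * e" using d0_pos T by (simp_all add: e_def)
  have vmax_eq: "vmax = vmin + e + l" by (simp add: l_def)
  have Tl_eq: "T * (vmax - vmin) - d0 = T * l" by (simp add: l_def e(2) algebra_simps)
  then have Tl: "0 < T * l" "T * l < D / 2" using d0_less d_less d0_pos by linarith+
  then have l: "0 < l" using T by (simp add: zero_less_mult_iff)
  have u: "vmax - e < u" "u \<le> vmax"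
    using eps T by (simp_all add: u_def e_def divide_right_mono)
  have "q2 * D \<le> T * l" using q(4) D Tl_eq by (simp add: field_simps)
  then have "q2 * D / T \<le> l" using T by (simp add: field_simps)
  then have a: "vmin \<le> a" by (simp add: a_def vmax_eq)
  \<comment> \<open>If \<open>q2 = 0\<close> the interval is empty, but its component then has
    weight 0.\<close>
  have a_less: "a < vmax - e" if "q2 \<noteq> 0" using that q(2) D T by (simp add: a_def)
  have XS: "X \<in> mixed_strategies {vmin..vmax}"
    unfolding X_def using Tl D v_le e(1) l vmax_eq
    by (intro mixture_mixed_strategies)
       (auto intro!: point_mass_mixed_strategies uniform_on_mixed_strategies)
  have YS: "Y \<in> mixed_strategies {vmin..vmax}"
    unfolding Y_def using q d_less D v_le e(1) l vmax_eq a a_less u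
    by (intro mixture_mixed_strategies)
       (auto intro!: point_mass_mixed_strategies uniform_on_mixed_strategies)
  have gapY: "gap_snd Y v = d0 + T * ((\<integral>w. w \<partial>Y) - v) +
      (if v - e < vmin then 0 else if v - e = vmin then d0 / 2 else d0 + T * (v - e - vmin))"
    if "p > 0" "v \<in> {vmin..vmax}" for v
  proof -
    \<comment> \<open>For \<open>p > 0\<close> the two bounds on \<open>q2\<close> coincide; this
      forces \<open>q1 = d0 / D\<close> and stretches the uniform part down to
      \<open>vmin\<close>.\<close>
    have q2: "q2 = T * l / D" using q(4) q(5)[OF that(1)] Tl_eq by simp
    have q1: "q1 = d0 / D" using q(3) q2 D by (simp add: e(2) vmax_eq field_simps)
    have av: "a = vmin" "vmax - e = vmin + l" using D T by (simp_all add: a_def q2 vmax_eq)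
    \<comment> \<open>No admissible \<open>v\<close> gives a threshold \<open>v - e\<close> reaching
      \<open>u\<close>, so the top atom drops out of all relevant events.\<close>
    have meas: "D * measure Y A = d0 * indicator A vmin + T * l * measure (uniform_on vmin (vmin + l)) A"
      if A: "A \<in> sets borel" "u \<notin> A" for A
    proof -
      have "measure Y A = d0 / D * measure (point_mass vmin) A
          + T * l / D * measure (uniform_on vmin (vmin + l)) A
          + (1 - T * (vmax - vmin) / D) * measure (point_mass u) A"
        unfolding Y_def
        using A(1) Tl(1) D d_less d0_pos prob_space_uniform_on[of vmin "vmin + l"] l
        by (subst measure_mixture)
           (auto simp: q1 q2 av prob_space_return intro!: prob_space.finite_measure)
      then show ?thesis
        using A D by (simp add: measure_point_mass distrib_left)
    qed
    have "D * measure Y {..<v - e} = d0 * indicator {..<v - e} vmin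
        + (if v - e \<le> vmin then 0 else T * (v - e - vmin))"
      using u that vmax_eq l by (subst meas) (auto simp: measure_uniform_on_lessThan)
    moreover have "D * measure Y {v - e} = d0 * indicator {v - e} vmin"
      using u that l by (subst meas) (auto simp: measure_uniform_on_singleton)
    then have "D / 2 * measure Y {v - e} = d0 * indicator {v - e} vmin / 2"
      by simp
    ultimately show ?thesis
      unfolding gap_snd_def e_def[symmetric] by (simp add: indicator_def)
  qed
  have gapX: "gap_fst X w = d0 + T * (w - (\<integral>v. v \<partial>X)) + (if w + e \<le> vmax then T * (vmax - e - w) else 0)"
    if "w \<in> {vmin..vmax}" for w
  proof -
    \<comment> \<open>The thresholds \<open>w + e\<close> exceed \<open>vmin\<close>, so the atom of
      \<open>X\<close> at \<open>vmin\<close> never overtakes or ties.\<close>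
    have meas: "D * measure X A = T * l * measure (uniform_on (vmin + e) vmax) A"
      if A: "A \<in> sets borel" "vmin \<notin> A" for A
    proof -
      have "measure X A = (1 - T * l / D) * measure (point_mass vmin) A
          + T * l / D * measure (uniform_on (vmin + e) vmax) A"
        unfolding X_def
        using A(1) Tl D prob_space_uniform_on[of "vmin + e" vmax] l vmax_eq
        by (subst measure_mixture) (auto simp: prob_space_return intro!: prob_space.finite_measure)
      then show ?thesis
        using A D by (simp add: measure_point_mass)
    qed
    have "D * measure X {w + e<..} = (if w + e \<le> vmax then T * (vmax - e - w) else 0)"
      using that e(1) vmax_eq l by (subst meas) (auto simp: measure_uniform_on_greaterThan)
    moreover have "D * measure X {w + e} = 0"
      using that e(1) vmax_eq l by (subst meas) (auto simp: measure_uniform_on_singleton)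
    then have "D / 2 * measure X {w + e} = 0"
      by simp
    ultimately show ?thesis
      unfolding gap_fst_def e_def[symmetric] by simp
  qed
  have "bus_eps_equilibrium D T vmin vmax lam p c x0 y0 (p * lam * eps) X Y"
  proof (rule eps_equilibrium_gapI[OF XS YS, where C = "d0 + T * ((\<integral>w. w \<partial>Y) - vmin)"
        and m = "d0 + T * (vmax - e - (\<integral>v. v \<partial>X))"])
    show "gap_snd Y v \<le> d0 + T * ((\<integral>w. w \<partial>Y) - vmin)" if "p > 0" "v \<in> {vmin..vmax}" for v
    proof -
      have "T * vmin \<le> T * v" using that T by simp
      moreover have "v = vmin + e" if "v - e = vmin" using that by simp
      ultimately show ?thesis
        unfolding gapY[OF that] using d0_pos by (auto simp: e(2) algebra_simps)
    qed
    \<comment> \<open>The open interval avoids the tie speed \<open>vmin + e\<close>, where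
      \<open>x\<close> would recover only \<open>d0 / 2\<close> of the loss
      \<open>d0\<close>.\<close>
    have "AE v in X. v \<in> insert vmin {vmin + e<..<vmax}"
      using XS Tl D e(1) l vmax_eq unfolding X_def
      by (intro AE_mixture) (auto intro!: emeasure_uniform_on_eq_1)
    then show "AE v in X. d0 + T * ((\<integral>w. w \<partial>Y) - vmin) \<le> gap_snd Y v + eps" if "p > 0"
    proof eventually_elim
      case (elim v)
      then have "v \<in> {vmin..vmax}" using e(1) l vmax_eq by auto
      from gapY[OF that this] show ?case
        using elim eps(1) e(1) l by (auto simp: e(2) algebra_simps)
    qed
    show "d0 + T * (vmax - e - (\<integral>v. v \<partial>X)) \<le> gap_fst X w" if "w \<in> {vmin..vmax}" for w
    proof -
      have "T * vmax \<le> T * (w + e)" if "\<not> w + e \<le> vmax" using that T by simp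
      then show ?thesis unfolding gapX[OF that] by (auto simp: algebra_simps)
    qed
    have "AE w in Y. w \<in> insert vmin (insert u {vmin<..<vmax - e})"
      using YS q d_less D a a_less unfolding Y_def
      by (intro AE_mixture) (auto intro!: emeasure_uniform_on_eq_1)
    then show "AE w in Y. gap_fst X w \<le> d0 + T * (vmax - e - (\<integral>v. v \<partial>X)) + eps"
    proof eventually_elim
      case (elim w)
      have "T * u = T * (vmax - e) + eps" using T by (simp add: u_def algebra_simps)
      with elim show ?case
        using u e(1) l eps(1) vmax_eq by (auto simp: gapX algebra_simps)
    qed
  qed (use eps in simp)
  then show ?thesis
    by (simp only: X_def Y_def a_def u_def e_def Tl_eq)
qed

text \<open>Overtaking is impossible, and a tie occurs only for \<open>vmax\<close> against
  \<open>vmin\<close>. The weight \<open>2 * d0 / D\<close> makes the tie worth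
  \<open>D / 2 * (2 * d0 / D) = d0\<close> to \<open>x\<close>, exactly the cost of driving at
  \<open>vmax\<close>. The weight \<open>2 * eps / D\<close> makes it cost \<open>y\<close> the
  length \<open>eps\<close>, the same as moving up to \<open>vmin + eps / T\<close>.\<close>

lemma eps_equilibrium_critical:
  assumes d_pos: "0 < d0" and d0_eq: "T * (vmax - vmin) = d0"
    and eps: "0 < eps" "eps \<le> d0"
  shows "bus_eps_equilibrium D T vmin vmax lam p c x0 y0 (p * lam * eps)
    (mixture
      [(1 - 2 * eps / D, point_mass vmin),
       (2 * eps / D, point_mass vmax)])
    (mixture
      [(2 * d0 / D, point_mass vmin),
       (1 - 2 * d0 / D, point_mass (vmin + eps / T))])"
proof -
  define X where "X = mixture [(1 - 2 * eps / D, point_mass vmin), (2 * eps / D, point_mass vmax)]"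
  define u where "u = vmin + eps / T"
  define Y where "Y = mixture [(2 * d0 / D, point_mass vmin), (1 - 2 * d0 / D, point_mass u)]"
  have e: "d0 / T = vmax - vmin" using d0_eq T by (simp add: field_simps)
  have d0_lt: "2 * d0 < D" using d_less d0_eq by simp
  have u: "vmin < u" "u \<le> vmax"
    using eps T e divide_right_mono[of eps d0 T] by (auto simp: u_def)
  have XS: "X \<in> mixed_strategies {vmin..vmax}"
    unfolding X_def using eps d0_lt D v_le
    by (intro mixture_mixed_strategies) (auto intro!: point_mass_mixed_strategies)
  have YS: "Y \<in> mixed_strategies {vmin..vmax}"
    unfolding Y_def using d_pos d0_lt D v_le u
    by (intro mixture_mixed_strategies) (auto intro!: point_mass_mixed_strategies)
  have "vmin < vmax" using u by simp
  have gapY: "gap_snd Y v = d0 + T * ((\<integral>w. w \<partial>Y) - v) + (if v = vmax then d0 else 0)"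
    if "v \<in> {vmin..vmax}" for v
  proof -
    have "measure Y A = 2 * d0 / D * indicator A vmin + (1 - 2 * d0 / D) * indicator A u"
      if "A \<in> sets borel" for A
      unfolding Y_def using that d_pos d0_lt D
      by (subst measure_mixture)
         (auto simp: measure_point_mass prob_space_return intro!: prob_space.finite_measure)
    with that u D show ?thesis
      by (auto simp: gap_snd_def e indicator_def)
  qed
  have gapX: "gap_fst X w = d0 + T * (w - (\<integral>v. v \<partial>X)) + (if w = vmin then eps else 0)"
    if "w \<in> {vmin..vmax}" for w
  proof -
    have "measure X A = (1 - 2 * eps / D) * indicator A vmin + 2 * eps / D * indicator A vmax"
      if "A \<in> sets borel" for A
      unfolding X_def using that eps d0_lt D
      by (subst measure_mixture)
         (auto simp: measure_point_mass prob_space_return intro!: prob_space.finite_measure)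
    with that \<open>vmin < vmax\<close> D show ?thesis
      by (auto simp: gap_fst_def e indicator_def)
  qed
  have "bus_eps_equilibrium D T vmin vmax lam p c x0 y0 (p * lam * eps) X Y"
  proof (rule eps_equilibrium_gapI[OF XS YS, where C = "d0 + T * ((\<integral>w. w \<partial>Y) - vmin)"
        and m = "d0 + T * (vmin - (\<integral>v. v \<partial>X))"])
    show "gap_snd Y v \<le> d0 + T * ((\<integral>w. w \<partial>Y) - vmin)" if "v \<in> {vmin..vmax}" for v
      unfolding gapY[OF that] using that T d0_eq by (auto simp: algebra_simps)
    have "AE v in X. v \<in> {vmin, vmax}"
      using XS eps d0_lt D unfolding X_def by (intro AE_mixture) auto
    then show "AE v in X. d0 + T * ((\<integral>w. w \<partial>Y) - vmin) \<le> gap_snd Y v + eps"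
      by eventually_elim (use eps v_le d0_eq d_pos in \<open>auto simp: gapY algebra_simps\<close>)
    show "d0 + T * (vmin - (\<integral>v. v \<partial>X)) \<le> gap_fst X w" if "w \<in> {vmin..vmax}" for w
      unfolding gapX[OF that] using that T eps by (auto simp: algebra_simps)
    have "AE w in Y. w \<in> {vmin, u}"
      using YS d_pos d0_lt D unfolding Y_def by (intro AE_mixture) auto
    then show "AE w in Y. gap_fst X w \<le> d0 + T * (vmin - (\<integral>v. v \<partial>X)) + eps"
    proof eventually_elim
      case (elim w)
      have "T * u = T * vmin + eps" using T by (simp add: u_def algebra_simps)
      with elim u v_le show ?case by (auto simp: gapX algebra_simps)
    qed
  qed (use eps in simp)
  then show ?thesis by (simp only: X_def Y_def u_def)
qed

end

text \<open>For \<open>p = 0\<close> every pair of mixed strategies is an equilibrium, so uniqueness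
  is stated for \<open>p > 0\<close> or a single speed. The number \<open>eps\<close> is a length
  and \<open>p * lam * eps\<close> the corresponding payoff. If \<open>p > 0\<close> and
  \<open>q2\<close> were below \<open>(d - d0) / D\<close>, the atom of \<open>Y\<close> at
  \<open>vmin\<close> would exceed \<open>d0 / D\<close> and a speed just above
  \<open>vmin + d0 / T\<close> would gain \<open>x\<close> an amount bounded away from 0; hence the
  lower bound on \<open>q2\<close>.\<close>

theorem theorem1:
  fixes D T vmin vmax lam p c x0 y0 d0 d :: real
  assumes "D > 0" and "T > 0" and "0 < vmin" and "vmin \<le> vmax"
    and "lam > 0" and "p \<ge> 0" and "c \<ge> 0" and "T * vmax < D / 2"
    and "x0 \<in> {0..<D}" and "y0 \<in> {0..<D}"
    and "d0 = min (dist_x D x0 y0) (dist_y D x0 y0)"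
    and "d = T * (vmax - vmin)"
    and "d0 = dist_x D x0 y0"
  shows
    "(d0 = 0 \<longrightarrow>
        bus_nash_equilibrium D T vmin vmax lam p c x0 y0 (point_mass vmax) (point_mass vmax) \<and>
        (p > 0 \<or> vmin = vmax \<longrightarrow>
          (\<forall>X Y. bus_nash_equilibrium D T vmin vmax lam p c x0 y0 X Y \<longrightarrow>
             X = point_mass vmax \<and> Y = point_mass vmax)))
     \<and>
     (0 < d0 \<and> d0 < d \<and> d < dist_y D x0 y0 \<longrightarrow>
        (\<forall>q1 q2. 0 \<le> q1 \<and> 0 \<le> q2 \<and> q1 + q2 = d / D \<and> q2 \<le> (d - d0) / D \<and>
           (p > 0 \<longrightarrow> (d - d0) / D \<le> q2) \<longrightarrow>
           (\<forall>\<^sub>F eps in at_right 0.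
              bus_eps_equilibrium D T vmin vmax lam p c x0 y0 (p * lam * eps)
                (mixture
                  [(1 - (d - d0) / D, point_mass vmin),
                   ((d - d0) / D, uniform_on (vmin + d0 / T) vmax)])
                (mixture
                  [(q1, point_mass vmin),
                   (q2, uniform_on (vmax - d0 / T - q2 * D / T) (vmax - d0 / T)),
                   (1 - d / D, point_mass (vmax - d0 / T + eps / T))]))))
     \<and>
     (0 < d \<and> d = d0 \<and> d0 < dist_y D x0 y0 \<longrightarrow>
        (\<forall>\<^sub>F eps in at_right 0.
           bus_eps_equilibrium D T vmin vmax lam p c x0 y0 (p * lam * eps)
             (mixture
               [(1 - 2 * eps / D, point_mass vmin),
                (2 * eps / D, point_mass vmax)])
             (mixture
               [(2 * d / D, point_mass vmin),
                (1 - 2 * d / D, point_mass (vmin + eps / T))])))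
     \<and>
     (d < d0 \<longrightarrow>
        bus_nash_equilibrium D T vmin vmax lam p c x0 y0 (point_mass vmin) (point_mass vmin) \<and>
        (p > 0 \<or> vmin = vmax \<longrightarrow>
          (\<forall>X Y. bus_nash_equilibrium D T vmin vmax lam p c x0 y0 X Y \<longrightarrow>
             X = point_mass vmin \<and> Y = point_mass vmin)))"
proof -
  \<comment> \<open>The directed distances are both 0 or add up to \<open>D\<close>, so their
    minimum is at most \<open>D / 2\<close>.\<close>
  have "d0 \<le> D / 2"
    using assms(1,9,10,11) by (auto simp: dist_x_def dist_y_def min_def split: if_splits)
  then interpret bus_game D T vmin vmax lam p c x0 y0 d0
    using assms by unfold_locales auto
  \<comment> \<open>The bound \<open>eps <= d0\<close> keeps the perturbed speed of \<open>y\<close>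
    at most \<open>vmax\<close> in both mixed cases, and the weights of \<open>X\<close> nonnegative
    in the critical one.\<close>
  have small: "\<forall>\<^sub>F eps in at_right 0. 0 < eps \<and> eps \<le> d0" if "0 < d0"
    using eventually_at_right_less[of 0] eventually_at_right_real[OF that]
    by eventually_elim auto
  show ?thesis
    unfolding assms(12)
  proof (intro conjI impI allI)
    fix q1 q2
    assume "0 < d0 \<and> d0 < T * (vmax - vmin) \<and> T * (vmax - vmin) < dist_y D x0 y0"
      and "0 \<le> q1 \<and> 0 \<le> q2 \<and> q1 + q2 = T * (vmax - vmin) / D
        \<and> q2 \<le> (T * (vmax - vmin) - d0) / D \<and> (p > 0 \<longrightarrow> (T * (vmax - vmin) - d0) / D \<le> q2)"
    then show "\<forall>\<^sub>F eps in at_right 0. bus_eps_equilibrium D T vmin vmax lam p c x0 y0 (p * lam * eps)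
        (mixture
          [(1 - (T * (vmax - vmin) - d0) / D, point_mass vmin),
           ((T * (vmax - vmin) - d0) / D, uniform_on (vmin + d0 / T) vmax)])
        (mixture
          [(q1, point_mass vmin),
           (q2, uniform_on (vmax - d0 / T - q2 * D / T) (vmax - d0 / T)),
           (1 - T * (vmax - vmin) / D, point_mass (vmax - d0 / T + eps / T))])"
      using small by (auto elim!: eventually_mono intro!: eps_equilibrium_mixed)
  next
    assume "0 < T * (vmax - vmin) \<and> T * (vmax - vmin) = d0 \<and> d0 < dist_y D x0 y0"
    then have d: "T * (vmax - vmin) = d0" "0 < d0" by auto
    show "\<forall>\<^sub>F eps in at_right 0. bus_eps_equilibrium D T vmin vmax lam p c x0 y0 (p * lam * eps)
        (mixture [(1 - 2 * eps / D, point_mass vmin), (2 * eps / D, point_mass vmax)])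
        (mixture [(2 * (T * (vmax - vmin)) / D, point_mass vmin),
          (1 - 2 * (T * (vmax - vmin)) / D, point_mass (vmin + eps / T))])"
      unfolding d(1) using small[OF d(2)] by (auto elim!: eventually_mono intro!: eps_equilibrium_critical d)
  qed (use nash_equilibrium_vmax nash_equilibrium_vmin in blast)+
qed

end
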